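(* Let $m\ge 1$, let $(p_i(n))_{n\ge 0}$, $1\le i\le m$, be sequences of nonnegative real numbers with $\sum_{i=1}^m p_i(n)<1$ for all $n\ge 0$, and let $(\sigma_i(n))_{n\ge 1}$, $1\le i\le m$, be sequences of integers such that $\sigma_i(n)\ge n+1$ for all $n\ge 1$, $1\le i\le m$. Let $\rho_i(n)=\min_{s\ge n}\sigma_i(s)$ and $\rho(n)=\min_{1\le i\le m}\rho_i(n)$ for $n\ge 1$, and let $$\alpha=\min_{1\le i\le m}\alpha_i,\qquad \alpha_i=\liminf_{n\to\infty}\sum_{j=n+1}^{\rho_i(n)}p_i(j).$$ Let $b_r(n,k)$ be defined by $$b_1(n,k)=\prod_{i=n+1}^{k}\Big[1-\sum_{\ell=1}^m p_\ell(i)\Big],\qquad b_{r+1}(n,k)=\prod_{i=n+1}^{k}\Big[1-\sum_{\ell=1}^m p_\ell(i)\,b_r^{-1}(i,\sigma_\ell(i))\Big],\quad r\in\mathbb{N}.$$ If $0<\alpha\le 1/e$ and for some $r\in\mathbb{N}$ $$\limsup_{n\to\infty}\sum_{j=n}^{\rho(n)}\sum_{i=1}^{m}p_i(j)\,b_r^{-1}(\rho(n),\sigma_i(j))>1-\frac{1-\alpha-\sqrt{1-2\alpha-\alpha^2}}{2},$$ then all solutions of the difference equation $$\nabla x(n)-\sum_{i=1}^m p_i(n)\,x(\sigma_i(n))=0,\qquad n\ge 1,$$ oscillate.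
   Context: $\mathbb{N}=\{1,2,\dots\}$. $\nabla x(n)=x(n)-x(n-1)$. A solution of the equation is a real sequence $(x(n))_{n\ge 0}$ satisfying the equation for all $n\ge 1$. A solution is oscillatory (oscillates) if it is neither eventually positive nor eventually negative. Empty products equal $1$, and $b_r^{-1}(n,k)$ means $1/b_r(n,k)$. *)

theory Defs
  imports "HOL-Library.Extended_Real" "HOL-Library.Liminf_Limsup"
begin

text \<open>Sequences of a family are written \<open>p i n\<close> and \<open>\<sigma> i n\<close>, with \<open>i \<in> {1..m}\<close>.
  The arguments \<open>\<sigma> i n\<close> are taken in \<open>nat\<close>; this loses nothing, since they are at least \<open>n + 1\<close>.\<close>

text \<open>On \<open>nat\<close> the infimum of a nonempty set is its least element, so the minimum is attained.\<close>

definition rho_i :: "(nat \<Rightarrow> nat \<Rightarrow> nat) \<Rightarrow> nat \<Rightarrow> nat \<Rightarrow> nat" where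
  "rho_i \<sigma> i n = (INF s\<in>{n..}. \<sigma> i s)"

definition rho :: "nat \<Rightarrow> (nat \<Rightarrow> nat \<Rightarrow> nat) \<Rightarrow> nat \<Rightarrow> nat" where
  "rho m \<sigma> n = (MIN i\<in>{1..m}. rho_i \<sigma> i n)"

text \<open>The liminf is taken in the extended reals because the sums may be unbounded.\<close>

definition alpha_i :: "(nat \<Rightarrow> nat \<Rightarrow> real) \<Rightarrow> (nat \<Rightarrow> nat \<Rightarrow> nat) \<Rightarrow> nat \<Rightarrow> ereal" where
  "alpha_i p \<sigma> i = liminf (\<lambda>n. ereal (\<Sum>j=n+1..rho_i \<sigma> i n. p i j))"

text \<open>The index \<open>r\<close> starts at 1; the value at \<open>r = 0\<close> is a dummy. From \<open>r = 2\<close> on a factor can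
  vanish, in which case the reciprocal of the product is 0 by the convention \<open>inverse 0 = 0\<close>.\<close>

fun b_r :: "nat \<Rightarrow> (nat \<Rightarrow> nat \<Rightarrow> real) \<Rightarrow> (nat \<Rightarrow> nat \<Rightarrow> nat) \<Rightarrow> nat \<Rightarrow> nat \<Rightarrow> nat \<Rightarrow> real" where
  "b_r m p \<sigma> 0 n k = 1"
| "b_r m p \<sigma> (Suc 0) n k = (\<Prod>i=n+1..k. 1 - (\<Sum>l=1..m. p l i))"
| "b_r m p \<sigma> (Suc (Suc r)) n k =
     (\<Prod>i=n+1..k. 1 - (\<Sum>l=1..m. p l i * inverse (b_r m p \<sigma> (Suc r) i (\<sigma> l i))))"

definition is_solution ::
  "nat \<Rightarrow> (nat \<Rightarrow> nat \<Rightarrow> real) \<Rightarrow> (nat \<Rightarrow> nat \<Rightarrow> nat) \<Rightarrow> (nat \<Rightarrow> real) \<Rightarrow> bool" where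
  "is_solution m p \<sigma> x \<longleftrightarrow>
     (\<forall>n\<ge>1. (x n - x (n - 1)) - (\<Sum>i=1..m. p i n * x (\<sigma> i n)) = 0)"

definition oscillatory :: "(nat \<Rightarrow> real) \<Rightarrow> bool" where
  "oscillatory x \<longleftrightarrow> \<not> (\<forall>\<^sub>F n in sequentially. x n > 0) \<and> \<not> (\<forall>\<^sub>F n in sequentially. x n < 0)"

end

theory Submission
  imports Defs
begin

text \<open>
  An eventually positive solution is eventually nondecreasing and satisfies
  \<open>x(n) - x(n - 1) \<ge> P(n) x(\<rho>(n))\<close> with \<open>P = p\<^sub>1 + \<dots> + p\<^sub>m\<close>. Summing the equation from \<open>n\<close> to
  \<open>\<rho>(n)\<close> and inserting \<open>x(\<sigma>\<^sub>i(j)) \<ge> b\<^sub>r\<^sup>-\<^sup>1(\<rho>(n), \<sigma>\<^sub>i(j)) x(\<rho>(n))\<close> bounds the sum in the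
  hypothesis by \<open>1 - x(n - 1) / x(\<rho>(n))\<close>. It remains to bound the lower limit \<open>M\<close> of
  \<open>x(n - 1) / x(\<rho>(n))\<close> from below: summing the difference inequality twice, over a stretch of
  \<open>P\<close>-mass \<open>\<alpha>\<close> before \<open>n\<close>, gives \<open>M (1 - \<alpha> - M) \<ge> \<alpha>\<^sup>2 / 2\<close>, so \<open>M\<close> is at least the smaller root
  \<open>(1 - \<alpha> - \<surd>(1 - 2\<alpha> - \<alpha>\<^sup>2)) / 2\<close> of the corresponding quadratic.
\<close>

section \<open>Lower bound for the ratio \<open>x (n - 1) / x (\<rho> n)\<close>\<close>

text \<open>A left Riemann sum dominates the integral of the decreasing function \<open>A - s\<close>.\<close>

lemma sum_mult_remaining_ge:
  fixes P :: "nat \<Rightarrow> real"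
  assumes "k \<le> n"
  shows "A\<^sup>2 / 2 - (A - (\<Sum>j=k..<n. P j))\<^sup>2 / 2 \<le> (\<Sum>j=k..<n. P j * (A - (\<Sum>u=Suc j..<n. P u)))"
  using assms
proof (induction k rule: inc_induct)
  case base
  then show ?case by simp
next
  case (step k)
  define a where "a = A - (\<Sum>u=Suc k..<n. P u)"
  have S: "(\<Sum>j=k..<n. P j) = P k + (\<Sum>j=Suc k..<n. P j)"
    using step.hyps by (simp add: sum.atLeast_Suc_lessThan)
  have T: "(\<Sum>j=k..<n. P j * (A - (\<Sum>u=Suc j..<n. P u)))
      = P k * a + (\<Sum>j=Suc k..<n. P j * (A - (\<Sum>u=Suc j..<n. P u)))"
    using step.hyps by (simp add: sum.atLeast_Suc_lessThan a_def)
  have "A - (\<Sum>j=k..<n. P j) = a - P k" by (simp add: S a_def)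
  moreover have "a\<^sup>2 / 2 - (a - P k)\<^sup>2 / 2 \<le> P k * a"
  proof -
    have "a\<^sup>2 - (a - P k)\<^sup>2 = 2 * (P k * a) - (P k)\<^sup>2" by (simp add: power2_diff)
    then show ?thesis using zero_le_power2[of "P k"] by linarith
  qed
  ultimately show ?case using step.IH by (simp add: T flip: a_def)
qed

lemma sum_diff_pred:
  fixes x :: "nat \<Rightarrow> 'a::ab_group_add"
  assumes "1 \<le> k" "k \<le> n"
  shows "(\<Sum>j=k..<n. x j - x (j - 1)) = x (n - 1) - x (k - 1)"
  using assms(2,1) by (induction n rule: dec_induct) auto

text \<open>Improvement step for the ratio \<open>x (n - 1) / x (\<rho> n)\<close>: summing
  \<open>ineq\<close> twice turns a lower bound \<open>d\<close> into the new one
  \<open>A^2 / 2 / (1 - A - d)\<close>, once the denominator is known to be positive. The quadratic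
  for the lower limit comes from a fixed point of this map.\<close>

lemma ratio_bound_improve:
  fixes x P :: "nat \<Rightarrow> real" and \<rho> :: "nat \<Rightarrow> nat"
  assumes K: "K \<ge> 1"
    and pos: "\<And>n. n \<ge> K - 1 \<Longrightarrow> x n > 0"
    and mono: "\<And>a b. K - 1 \<le> a \<Longrightarrow> a \<le> b \<Longrightarrow> x a \<le> x b"
    and P: "\<And>n. P n \<ge> 0"
    and \<rho>_mono: "\<And>a b. K \<le> a \<Longrightarrow> a \<le> b \<Longrightarrow> \<rho> a \<le> \<rho> b"
    and ineq: "\<And>n. n \<ge> K \<Longrightarrow> P n * x (\<rho> n) \<le> x n - x (n - 1)"
    and sums: "\<And>n. n \<ge> K \<Longrightarrow> A \<le> (\<Sum>j=Suc n..\<rho> n. P j)"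
    and A: "A > 0" and d0: "d \<ge> 0"
    and d: "\<And>n. n \<ge> K \<Longrightarrow> d * x (\<rho> n) \<le> x (n - 1)"
    and n: "n > \<rho> K"
  shows "A\<^sup>2 / 2 * x (\<rho> n) \<le> (1 - A - d) * x (n - 1)"
proof -
  define S where "S k = (\<Sum>j=k..<n. P j)" for k
  have S_antimono: "S b \<le> S a" if "a \<le> b" for a b
    unfolding S_def using that P by (intro sum_mono2) auto
  \<comment> \<open>The stretch \<open>{k..<n}\<close> is the shortest one ending at \<open>n - 1\<close> whose mass is at least \<open>A\<close>.\<close>
  define Q where "Q = {k. K \<le> k \<and> k < n \<and> A \<le> S k}"
  have Kn: "K < n"
  proof (rule ccontr)
    assume "\<not> K < n"
    then have "\<rho> K < K" using n by simp
    then show False using sums[of K] A by simp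
  qed
  have "(\<Sum>j=Suc K..\<rho> K. P j) \<le> S K"
    unfolding S_def using P n by (intro sum_mono2) auto
  then have "K \<in> Q" using sums[of K] Kn by (simp add: Q_def)
  moreover have "finite Q" by (simp add: Q_def)
  ultimately have "Max Q \<in> Q" and max: "\<And>j. j \<in> Q \<Longrightarrow> j \<le> Max Q"
    by (auto intro: Max_in)
  then obtain k where k: "K \<le> k" "k < n" "A \<le> S k" and k_max: "\<And>j. j \<in> Q \<Longrightarrow> j \<le> k"
    unfolding Q_def by blast
  \<comment> \<open>By maximality of \<open>k\<close>, dropping the index \<open>k\<close> brings
    the remaining mass below \<open>A\<close>.\<close>
  have less: "S (Suc j) < A" if "j \<ge> k" for j
  proof -
    have "S (Suc k) < A"
    proof (cases "Suc k < n")
      case True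
      then show ?thesis using k_max[of "Suc k"] k by (force simp: Q_def)
    next
      case False
      then show ?thesis using A by (simp add: S_def)
    qed
    then show ?thesis using S_antimono[of "Suc k" "Suc j"] that by simp
  qed
  \<comment> \<open>The window from \<open>Suc j\<close> to \<open>\<rho> j\<close> has mass at
    least \<open>A\<close>, but \<open>{Suc j..<n}\<close> has less, so the window must extend to
    \<open>n\<close>.\<close>
  have reach: "n \<le> \<rho> j" if "j \<ge> k" for j
  proof (rule ccontr)
    assume "\<not> n \<le> \<rho> j"
    then have "(\<Sum>u=Suc j..\<rho> j. P u) \<le> S (Suc j)"
      unfolding S_def using P by (intro sum_mono2) auto
    then show False using sums[of j] less[of j] k that by simp
  qed
  \<comment> \<open>First summation, over \<open>n\<close> to \<open>\<rho> j\<close>. This part of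
    the window carries mass at least \<open>A - S (Suc j)\<close>, and each unit of mass there adds
    at least \<open>x (\<rho> n)\<close> by monotonicity.\<close>
  have inner: "x (n - 1) + (A - S (Suc j)) * x (\<rho> n) \<le> x (\<rho> j)" if j: "k \<le> j" "j < n" for j
  proof -
    have "A \<le> (\<Sum>u=Suc j..\<rho> j. P u)" using sums j k by simp
    also have "{Suc j..\<rho> j} = {Suc j..<n} \<union> {n..<Suc (\<rho> j)}" using reach[of j] j by auto
    also have "sum P \<dots> = S (Suc j) + (\<Sum>u=n..<Suc (\<rho> j). P u)"
      unfolding S_def by (subst sum.union_disjoint) auto
    finally have "(A - S (Suc j)) * x (\<rho> n) \<le> (\<Sum>u=n..<Suc (\<rho> j). P u) * x (\<rho> n)"
      using pos[of "\<rho> n"] reach[of n] k by (intro mult_right_mono) (auto intro: less_imp_le)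
    also have "\<dots> = (\<Sum>u=n..<Suc (\<rho> j). P u * x (\<rho> n))" by (rule sum_distrib_right)
    also have "\<dots> \<le> (\<Sum>u=n..<Suc (\<rho> j). x u - x (u - 1))"
    proof (rule sum_mono)
      fix u assume "u \<in> {n..<Suc (\<rho> j)}"
      then have u: "n \<le> u" by simp
      have "P u * x (\<rho> n) \<le> P u * x (\<rho> u)"
        using u k reach[of n] \<rho>_mono[of n u] by (intro mult_left_mono P mono) auto
      also have "\<dots> \<le> x u - x (u - 1)" using ineq u k by simp
      finally show "P u * x (\<rho> n) \<le> x u - x (u - 1)" .
    qed
    also have "\<dots> = x (\<rho> j) - x (n - 1)"
      using reach[of j] j k K by (subst sum_diff_pred) auto
    finally show ?thesis by simp
  qed
  \<comment> \<open>Second summation, over the stretch before \<open>n\<close>, with the bound just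
    obtained inserted for \<open>x (\<rho> j)\<close>.\<close>
  have "(\<Sum>j=k..<n. P j * (x (n - 1) + (A - S (Suc j)) * x (\<rho> n))) \<le> (\<Sum>j=k..<n. x j - x (j - 1))"
  proof (rule sum_mono)
    fix j assume "j \<in> {k..<n}"
    then have j: "k \<le> j" "j < n" by auto
    have "P j * (x (n - 1) + (A - S (Suc j)) * x (\<rho> n)) \<le> P j * x (\<rho> j)"
      using inner[OF j] P by (intro mult_left_mono) auto
    also have "\<dots> \<le> x j - x (j - 1)" using ineq j k by simp
    finally show "P j * (x (n - 1) + (A - S (Suc j)) * x (\<rho> n)) \<le> x j - x (j - 1)" .
  qed
  also have "\<dots> = x (n - 1) - x (k - 1)" using k K by (subst sum_diff_pred) auto
  finally have main: "S k * x (n - 1) + (\<Sum>j=k..<n. P j * (A - S (Suc j))) * x (\<rho> n)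
      \<le> x (n - 1) - x (k - 1)"
    by (simp only: distrib_left sum.distrib sum_distrib_right S_def[of k] mult.assoc)
  \<comment> \<open>Since \<open>S k\<close> may overshoot \<open>A\<close>, the Riemann bound on
    the whole stretch could lose \<open>(A - S k)^2 / 2\<close>. So the term at \<open>k\<close> is
    split off: the bound from \<open>Suc k\<close> on misses only \<open>a^2 / 2\<close>, and
    \<open>P k \<ge> a\<close> makes up for it.\<close>
  have "A\<^sup>2 / 2 \<le> (\<Sum>j=k..<n. P j * (A - S (Suc j)))"
  proof -
    define a where "a = A - S (Suc k)"
    have a: "0 \<le> a" using less[of k] by (simp add: a_def)
    have Sk: "S k = P k + S (Suc k)"
      using k by (simp add: S_def sum.atLeast_Suc_lessThan)
    have "A\<^sup>2 / 2 - a\<^sup>2 / 2 \<le> (\<Sum>j=Suc k..<n. P j * (A - S (Suc j)))"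
      unfolding a_def S_def using k by (intro sum_mult_remaining_ge) auto
    moreover have "a\<^sup>2 \<le> P k * a"
      unfolding power2_eq_square using a k Sk by (intro mult_right_mono) (auto simp: a_def)
    moreover have "a\<^sup>2 / 2 \<le> a\<^sup>2" by simp
    moreover have "(\<Sum>j=k..<n. P j * (A - S (Suc j)))
        = P k * a + (\<Sum>j=Suc k..<n. P j * (A - S (Suc j)))"
      using k by (simp add: sum.atLeast_Suc_lessThan a_def)
    ultimately show ?thesis by linarith
  qed
  moreover have "x (\<rho> n) > 0" using pos reach[of n] k by simp
  ultimately have "A\<^sup>2 / 2 * x (\<rho> n) \<le> (\<Sum>j=k..<n. P j * (A - S (Suc j))) * x (\<rho> n)"
    by (intro mult_right_mono) auto
  moreover have "A * x (n - 1) \<le> S k * x (n - 1)"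
    using k pos[of "n - 1"] by (intro mult_right_mono) (auto intro: less_imp_le)
  moreover have "d * x (n - 1) \<le> x (k - 1)"
  proof -
    have "d * x (n - 1) \<le> d * x (\<rho> k)"
      using d0 reach[of k] k by (intro mult_left_mono mono) auto
    also have "\<dots> \<le> x (k - 1)" using d k by simp
    finally show ?thesis .
  qed
  ultimately show ?thesis using main by (simp add: algebra_simps)
qed

text \<open>Completing the square gives \<open>(1 - \<alpha> - 2 * M)^2 = (1 - \<alpha>)^2 - 4 * M *
  (1 - \<alpha> - M)\<close>. The resulting bound also shows that the radicand is
  nonnegative.\<close>

lemma quadratic_lower_root:
  fixes \<alpha> M :: real
  assumes "\<alpha>\<^sup>2 / 2 \<le> M * (1 - \<alpha> - M)"
  shows "(1 - \<alpha> - sqrt (1 - 2 * \<alpha> - \<alpha>\<^sup>2)) / 2 \<le> M"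
proof -
  have "(1 - \<alpha> - 2 * M)\<^sup>2 \<le> 1 - 2 * \<alpha> - \<alpha>\<^sup>2"
    using assms by (simp add: power2_eq_square algebra_simps)
  then have "1 - \<alpha> - 2 * M \<le> sqrt (1 - 2 * \<alpha> - \<alpha>\<^sup>2)"
    by (rule real_le_rsqrt)
  then show ?thesis by (simp add: field_simps)
qed

lemma eventually_ratio_ge:
  fixes x P :: "nat \<Rightarrow> real" and \<rho> :: "nat \<Rightarrow> nat"
  assumes pos: "\<And>n. n \<ge> N \<Longrightarrow> x n > 0"
    and mono: "\<And>a b. N \<le> a \<Longrightarrow> a \<le> b \<Longrightarrow> x a \<le> x b"
    and P: "\<And>n. P n \<ge> 0"
    and \<rho>_mono: "\<And>a b. N < a \<Longrightarrow> a \<le> b \<Longrightarrow> \<rho> a \<le> \<rho> b"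
    and \<rho>_gt: "\<And>n. N < n \<Longrightarrow> n < \<rho> n"
    and ineq: "\<And>n. n > N \<Longrightarrow> P n * x (\<rho> n) \<le> x n - x (n - 1)"
    and sums: "\<And>A. A < \<alpha> \<Longrightarrow> \<forall>\<^sub>F n in sequentially. A \<le> (\<Sum>j=Suc n..\<rho> n. P j)"
    and \<alpha>: "\<alpha> > 0"
    and c: "c < (1 - \<alpha> - sqrt (1 - 2 * \<alpha> - \<alpha>\<^sup>2)) / 2"
  shows "\<forall>\<^sub>F n in sequentially. c * x (\<rho> n) \<le> x (n - 1)"
proof -
  \<comment> \<open>The supremum \<open>M\<close> of \<open>D\<close> plays the role of the lower
    limit of \<open>x (n - 1) / x (\<rho> n)\<close>; as \<open>x\<close> is nondecreasing,
    \<open>D\<close> is bounded by 1.\<close>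
  define D where "D = {d. 0 \<le> d \<and> (\<forall>\<^sub>F n in sequentially. d * x (\<rho> n) \<le> x (n - 1))}"
  define M where "M = Sup D"
  have zero: "0 \<in> D"
    unfolding D_def using pos
    by (auto simp: eventually_sequentially intro!: exI[of _ "Suc N"] less_imp_le)
  have le_1: "d \<le> 1" if "d \<in> D" for d
  proof -
    from that obtain L where L: "\<And>n. n \<ge> L \<Longrightarrow> d * x (\<rho> n) \<le> x (n - 1)"
      by (auto simp: D_def eventually_sequentially)
    define n where "n = max L (Suc N)"
    have n: "n \<ge> L" "n > N" by (auto simp: n_def)
    have "d * x (\<rho> n) \<le> x (n - 1)" by (rule L[OF n(1)])
    also have "\<dots> \<le> 1 * x (\<rho> n)" using mono[of "n - 1" "\<rho> n"] n \<rho>_gt[of n] by simp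
    finally show ?thesis using pos[of "\<rho> n"] \<rho>_gt[of n] n by (simp add: mult_le_cancel_right)
  qed
  then have bdd: "bdd_above D" by (auto simp: bdd_above_def)
  have upper: "d \<le> M" if "d \<in> D" for d
    unfolding M_def using that bdd by (rule cSup_upper)
  \<comment> \<open>The improved constant \<open>A^2 / 2 / (1 - A - d)\<close> lies in
    \<open>D\<close> again, hence is at most \<open>M\<close>. Its denominator is positive because
    the left side of the improved inequality is.\<close>
  have step: "A\<^sup>2 / 2 \<le> M * (1 - A - d)" if A: "0 < A" "A < \<alpha>" and "d \<in> D" for A d
  proof -
    from \<open>d \<in> D\<close> obtain L where d0: "d \<ge> 0" and L: "\<And>n. n \<ge> L \<Longrightarrow> d * x (\<rho> n) \<le> x (n - 1)"
      by (auto simp: D_def eventually_sequentially)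
    from sums[OF A(2)] obtain L' where L': "\<And>n. n \<ge> L' \<Longrightarrow> A \<le> (\<Sum>j=Suc n..\<rho> n. P j)"
      by (auto simp: eventually_sequentially)
    define K where "K = max (Suc N) (max L L')"
    have K: "K \<ge> 1" "K > N" "K \<ge> L" "K \<ge> L'" by (auto simp: K_def)
    have *: "A\<^sup>2 / 2 * x (\<rho> n) \<le> (1 - A - d) * x (n - 1)" if "n > \<rho> K" for n
      by (rule ratio_bound_improve[where K = K and P = P])
        (use K A P d0 L L' pos mono \<rho>_mono ineq that in auto)
    have "n > N \<and> 0 < x (n - 1) \<and> 0 < x (\<rho> n)" if "n > \<rho> K" for n
      using that \<rho>_gt[of K] \<rho>_gt[of n] K pos[of "n - 1"] pos[of "\<rho> n"] by simp
    note xpos = this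
    have gt: "1 - A - d > 0"
    proof -
      let ?n = "Suc (\<rho> K)"
      have "0 < A\<^sup>2 / 2 * x (\<rho> ?n)" using A xpos[of ?n] by simp
      also have "\<dots> \<le> (1 - A - d) * x (?n - 1)" by (rule *) simp
      finally show ?thesis using xpos[of ?n] by (simp add: zero_less_mult_iff)
    qed
    have "A\<^sup>2 / 2 / (1 - A - d) * x (\<rho> n) \<le> x (n - 1)" if "n > \<rho> K" for n
      using *[OF that] gt by (simp add: field_simps)
    then have "\<forall>\<^sub>F n in sequentially. A\<^sup>2 / 2 / (1 - A - d) * x (\<rho> n) \<le> x (n - 1)"
      unfolding eventually_sequentially by (intro exI[of _ "Suc (\<rho> K)"]) auto
    then have "A\<^sup>2 / 2 / (1 - A - d) \<in> D" using gt by (simp add: D_def)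
    from upper[OF this] gt show ?thesis by (simp add: field_simps)
  qed
  have M0: "M \<ge> 0" using upper[OF zero] .
  \<comment> \<open>Solving the previous bound for \<open>d\<close> and taking the supremum over
    \<open>D\<close> replaces \<open>d\<close> by \<open>M\<close>; the division requires
    \<open>M > 0\<close>.\<close>
  have sup: "A\<^sup>2 / 2 \<le> M * (1 - A - M)" if A: "0 < A" "A < \<alpha>" for A
  proof (cases "M = 0")
    case True
    then show ?thesis using step[OF A zero] by simp
  next
    case False
    then have "M > 0" using M0 by simp
    then have "d \<le> 1 - A - A\<^sup>2 / 2 / M" if "d \<in> D" for d
      using step[OF A that] by (simp add: field_simps)
    then have "M \<le> 1 - A - A\<^sup>2 / 2 / M"
      unfolding M_def[symmetric] using zero by (subst M_def) (intro cSup_least, auto)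
    then show ?thesis using \<open>M > 0\<close> by (simp add: field_simps)
  qed
  \<comment> \<open>The mass bound is available only for \<open>A < \<alpha>\<close>, hence the
    limit from the left.\<close>
  have "\<alpha>\<^sup>2 / 2 \<le> M * (1 - \<alpha> - M)"
  proof (rule tendsto_le)
    show "at_left \<alpha> \<noteq> bot" by simp
    show "((\<lambda>A. A\<^sup>2 / 2) \<longlongrightarrow> \<alpha>\<^sup>2 / 2) (at_left \<alpha>)" by (intro tendsto_intros) auto
    show "((\<lambda>A. M * (1 - A - M)) \<longlongrightarrow> M * (1 - \<alpha> - M)) (at_left \<alpha>)" by (intro tendsto_intros)
    show "\<forall>\<^sub>F A in at_left \<alpha>. A\<^sup>2 / 2 \<le> M * (1 - A - M)"
      using eventually_at_left_real[OF \<alpha>] by eventually_elim (use sup in auto)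
  qed
  then have "c < M" using quadratic_lower_root c by fastforce
  then obtain d where "d \<in> D" "c < d"
    unfolding M_def using zero bdd by (subst (asm) less_cSup_iff) auto
  then have "\<forall>\<^sub>F n in sequentially. d * x (\<rho> n) \<le> x (n - 1)" by (simp add: D_def)
  moreover have "\<forall>\<^sub>F n in sequentially. n > N" by (rule eventually_gt_at_top)
  ultimately show ?thesis
  proof eventually_elim
    case (elim n)
    have "c * x (\<rho> n) \<le> d * x (\<rho> n)"
      using \<open>c < d\<close> pos[of "\<rho> n"] \<rho>_gt[of n] elim by (intro mult_right_mono) auto
    then show ?case using elim by simp
  qed
qed

section \<open>Monotonicity and bounds for \<open>rho_i\<close> and \<open>rho\<close>\<close>

lemma rho_i_mono:
  assumes "a \<le> b"
  shows "rho_i \<sigma> i a \<le> rho_i \<sigma> i b"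
  unfolding rho_i_def using assms by (intro cINF_superset_mono) auto

lemma rho_i_le:
  assumes "n \<le> s"
  shows "rho_i \<sigma> i n \<le> \<sigma> i s"
  unfolding rho_i_def using assms by (intro cINF_lower) auto

lemma rho_le_rho_i:
  assumes "i \<in> {1..m}"
  shows "rho m \<sigma> n \<le> rho_i \<sigma> i n"
  unfolding rho_def using assms by (intro Min_le) auto

lemma rho_attained:
  assumes "m \<ge> 1"
  obtains i where "i \<in> {1..m}" "rho m \<sigma> n = rho_i \<sigma> i n"
proof -
  have "rho m \<sigma> n \<in> (\<lambda>i. rho_i \<sigma> i n) ` {1..m}"
    unfolding rho_def using assms by (intro Min_in) auto
  then show ?thesis using that by auto
qed

lemma rho_mono:
  assumes "m \<ge> 1" "a \<le> b"
  shows "rho m \<sigma> a \<le> rho m \<sigma> b"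
proof -
  obtain i where "i \<in> {1..m}" "rho m \<sigma> b = rho_i \<sigma> i b" using rho_attained[OF assms(1)] by metis
  then show ?thesis using rho_le_rho_i[of i m \<sigma> a] rho_i_mono[OF assms(2), of \<sigma> i] by simp
qed

lemma rho_le:
  assumes "i \<in> {1..m}" "n \<le> s"
  shows "rho m \<sigma> n \<le> \<sigma> i s"
  using rho_le_rho_i[OF assms(1), of \<sigma> n] rho_i_le[OF assms(2), of \<sigma> i] by simp

lemma rho_gt:
  assumes "m \<ge> 1" "n \<ge> 1" "\<And>i n. i \<in> {1..m} \<Longrightarrow> n \<ge> 1 \<Longrightarrow> \<sigma> i n \<ge> n + 1"
  shows "n < rho m \<sigma> n"
proof -
  obtain i where i: "i \<in> {1..m}" "rho m \<sigma> n = rho_i \<sigma> i n" using rho_attained[OF assms(1)] by metis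
  have "Suc n \<le> rho_i \<sigma> i n"
    unfolding rho_i_def using assms(2) assms(3)[OF i(1)]
    by (intro cINF_greatest) (auto intro: order_trans[of "Suc n" "Suc _"])
  then show ?thesis using i by simp
qed

section \<open>Growth of a positive solution measured by the products \<open>b_r\<close>\<close>

text \<open>A bound \<open>x (i - 1) \<le> (1 - F i) * x i\<close> multiplies up to a product over
  \<open>i\<close>. For \<open>r = 1\<close> it follows from monotonicity of \<open>x\<close>; from
  \<open>r\<close> to \<open>r + 1\<close>, the bound for \<open>b_r\<close> is inserted for
  \<open>x (\<sigma> l i)\<close> in the equation. Positivity is carried along so that
  \<open>inverse\<close> is a true reciprocal.\<close>

lemma le_b_r_mult:
  fixes x :: "nat \<Rightarrow> real"
  assumes pos: "\<And>n. n \<ge> N \<Longrightarrow> x n > 0"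
    and mono: "\<And>a b. N \<le> a \<Longrightarrow> a \<le> b \<Longrightarrow> x a \<le> x b"
    and p: "\<And>i n. i \<in> {1..m} \<Longrightarrow> p i n \<ge> 0"
    and \<sigma>: "\<And>i n. i \<in> {1..m} \<Longrightarrow> n > N \<Longrightarrow> \<sigma> i n \<ge> n + 1"
    and eq: "\<And>n. n > N \<Longrightarrow> x n - x (n - 1) = (\<Sum>i=1..m. p i n * x (\<sigma> i n))"
    and "N \<le> n" "n \<le> k" "r \<ge> 1"
  shows "b_r m p \<sigma> r n k > 0 \<and> x n \<le> b_r m p \<sigma> r n k * x k"
proof -
  have prod_bound: "0 < (\<Prod>i=n+1..k. 1 - F i) \<and> x n \<le> (\<Prod>i=n+1..k. 1 - F i) * x k"
    if F: "\<And>i. i > N \<Longrightarrow> F i * x i \<le> x i - x (i - 1)" and "N \<le> n" "n \<le> k" for F n k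
    using that(3)
  proof (induction k rule: dec_induct)
    case base
    then show ?case by simp
  next
    case (step k)
    have le: "x k \<le> (1 - F (Suc k)) * x (Suc k)"
      using F[of "Suc k"] step.hyps \<open>N \<le> n\<close> by (simp add: algebra_simps)
    moreover have "x k > 0" "x (Suc k) > 0" using pos step.hyps \<open>N \<le> n\<close> by auto
    \<comment> \<open>Positivity of the solution at \<open>k\<close> keeps the new factor from
      vanishing.\<close>
    ultimately have fac: "1 - F (Suc k) > 0" by (metis less_le_trans zero_less_mult_pos2)
    let ?B = "\<Prod>i=n+1..k. 1 - F i"
    have B: "(\<Prod>i=n+1..Suc k. 1 - F i) = ?B * (1 - F (Suc k))"
      using step.hyps by (simp add: prod.nat_ivl_Suc')
    have "x n \<le> ?B * x k" using step.IH by simp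
    also have "\<dots> \<le> ?B * ((1 - F (Suc k)) * x (Suc k))"
      using le step.IH by (intro mult_left_mono) auto
    finally show ?case unfolding B using step.IH fac by (simp add: mult.assoc)
  qed
  show ?thesis using \<open>r \<ge> 1\<close> \<open>N \<le> n\<close> \<open>n \<le> k\<close>
  proof (induction r arbitrary: n k rule: dec_induct)
    case base
    have "(\<Sum>l=1..m. p l i) * x i \<le> x i - x (i - 1)" if "i > N" for i
      unfolding eq[OF that] sum_distrib_right
      using that p \<sigma>[of _ i] by (intro sum_mono mult_left_mono mono) (auto dest: Suc_leD)
    from prod_bound[OF this] show ?case using base by simp
  next
    case (step r)
    have "(\<Sum>l=1..m. p l i * inverse (b_r m p \<sigma> r i (\<sigma> l i))) * x i \<le> x i - x (i - 1)"
      if "i > N" for i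
      unfolding eq[OF that] sum_distrib_right
    proof (rule sum_mono)
      fix l assume l: "l \<in> {1..m}"
      let ?b = "b_r m p \<sigma> r i (\<sigma> l i)"
      have "?b > 0 \<and> x i \<le> ?b * x (\<sigma> l i)"
        using that \<sigma>[OF l that] by (intro step.IH) auto
      then have "inverse ?b * x i \<le> x (\<sigma> l i)" by (simp add: field_simps)
      then show "p l i * inverse ?b * x i \<le> p l i * x (\<sigma> l i)"
        unfolding mult.assoc using p[OF l] by (intro mult_left_mono) auto
    qed
    \<comment> \<open>Splitting \<open>r\<close>, which is at least 1, exposes the
      \<open>Suc (Suc _)\<close> form of the recursive equation.\<close>
    from prod_bound[OF this] show ?case using step.prems step.hyps by (cases r) auto
  qed
qed

section \<open>Excluding eventually positive solutions, and oscillation\<close>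

lemma not_eventually_pos:
  fixes x :: "nat \<Rightarrow> real"
  assumes m: "m \<ge> 1"
    and p_nonneg: "\<And>i n. i \<in> {1..m} \<Longrightarrow> p i n \<ge> 0"
    and \<sigma>_adv: "\<And>i n. i \<in> {1..m} \<Longrightarrow> n \<ge> 1 \<Longrightarrow> \<sigma> i n \<ge> n + 1"
    and \<alpha>_eq: "ereal \<alpha> = (MIN i\<in>{1..m}. alpha_i p \<sigma> i)"
    and \<alpha>_pos: "0 < \<alpha>"
    and r: "r \<ge> 1"
    and limsup_gt: "limsup (\<lambda>n. ereal (\<Sum>j=n..rho m \<sigma> n. \<Sum>i=1..m.
                      p i j * inverse (b_r m p \<sigma> r (rho m \<sigma> n) (\<sigma> i j))))
                    > ereal (1 - (1 - \<alpha> - sqrt (1 - 2 * \<alpha> - \<alpha>\<^sup>2)) / 2)"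
    and sol: "is_solution m p \<sigma> x"
  shows "\<not> (\<forall>\<^sub>F n in sequentially. x n > 0)"
proof
  assume "\<forall>\<^sub>F n in sequentially. x n > 0"
  then obtain N where pos: "\<And>n. n \<ge> N \<Longrightarrow> x n > 0" by (auto simp: eventually_sequentially)
  define \<rho> where "\<rho> = rho m \<sigma>"
  define P where "P n = (\<Sum>i=1..m. p i n)" for n
  have eq: "x n - x (n - 1) = (\<Sum>i=1..m. p i n * x (\<sigma> i n))" if "n > N" for n
    using sol that unfolding is_solution_def by (auto dest: spec[of _ n])
  have \<sigma>_gt: "\<sigma> i n \<ge> n + 1" if "i \<in> {1..m}" "n > N" for i n
    using \<sigma>_adv that by simp
  have P: "P n \<ge> 0" for n unfolding P_def by (intro sum_nonneg p_nonneg)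
  have mono: "x a \<le> x b" if "N \<le> a" "a \<le> b" for a b
    using that(2)
  proof (induction b rule: dec_induct)
    case (step b)
    have "0 \<le> x (Suc b) - x (Suc b - 1)"
      unfolding eq[of "Suc b", OF le_imp_less_Suc[OF order_trans[OF \<open>N \<le> a\<close> step.hyps(1)]]]
    proof (intro sum_nonneg mult_nonneg_nonneg p_nonneg)
      fix i assume "i \<in> {1..m}"
      then have "\<sigma> i (Suc b) \<ge> N" using \<sigma>_gt[of i "Suc b"] step.hyps \<open>N \<le> a\<close> by simp
      then show "0 \<le> x (\<sigma> i (Suc b))" using pos less_imp_le by blast
    qed
    then show ?case using step.IH by simp
  qed simp
  have \<rho>_mono: "\<rho> a \<le> \<rho> b" if "a \<le> b" for a b
    unfolding \<rho>_def using m that by (rule rho_mono)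
  have \<rho>_gt: "n < \<rho> n" if "n > N" for n
    unfolding \<rho>_def using m that \<sigma>_adv by (intro rho_gt) auto
  have \<rho>_le: "\<rho> n \<le> \<sigma> i s" if "i \<in> {1..m}" "n \<le> s" for i n s
    unfolding \<rho>_def using that by (rule rho_le)
  have ineq: "P n * x (\<rho> n) \<le> x n - x (n - 1)" if "n > N" for n
    unfolding eq[OF that] P_def sum_distrib_right
    using that p_nonneg \<rho>_gt[of n] by (intro sum_mono mult_left_mono mono \<rho>_le) auto
  have sums: "\<forall>\<^sub>F n in sequentially. A \<le> (\<Sum>j=Suc n..\<rho> n. P j)" if "A < \<alpha>" for A
  proof -
    have "\<forall>\<^sub>F n in sequentially. A < (\<Sum>j=n+1..rho_i \<sigma> i n. p i j)" if i: "i \<in> {1..m}" for i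
    proof -
      have "ereal \<alpha> \<le> alpha_i p \<sigma> i" unfolding \<alpha>_eq using i by (intro Min_le) auto
      then have "ereal A < alpha_i p \<sigma> i" using \<open>A < \<alpha>\<close> by (metis less_ereal.simps(1) less_le_trans)
      from less_LiminfD[OF this[unfolded alpha_i_def]] show ?thesis by simp
    qed
    then have "\<forall>\<^sub>F n in sequentially. \<forall>i\<in>{1..m}. A < (\<Sum>j=n+1..rho_i \<sigma> i n. p i j)"
      by (intro eventually_ball_finite) auto
    then show ?thesis
    proof eventually_elim
      case (elim n)
      \<comment> \<open>The index attaining the minimum depends on \<open>n\<close>, but one such sequence suffices for each \<open>n\<close>.\<close>
      obtain i where i: "i \<in> {1..m}" "\<rho> n = rho_i \<sigma> i n"
        unfolding \<rho>_def using rho_attained[OF m] by metis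
      have "A \<le> (\<Sum>j=n+1..\<rho> n. p i j)" using elim i by force
      also have "\<dots> \<le> (\<Sum>j=n+1..\<rho> n. P j)"
        unfolding P_def using i p_nonneg by (intro sum_mono member_le_sum) auto
      finally show ?case by simp
    qed
  qed
  \<comment> \<open>A real strictly between the threshold and the limsup: \<open>1 - c'\<close> is
    then below the quadratic root, so it is eventually a lower bound for the ratio, and the sums
    will be shown to be eventually at most \<open>c'\<close>.\<close>
  obtain c' where c': "1 - (1 - \<alpha> - sqrt (1 - 2 * \<alpha> - \<alpha>\<^sup>2)) / 2 < c'"
    and limsup_c': "ereal c' < limsup (\<lambda>n. ereal (\<Sum>j=n..\<rho> n. \<Sum>i=1..m.
                      p i j * inverse (b_r m p \<sigma> r (\<rho> n) (\<sigma> i j))))"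
    using ereal_dense2[OF limsup_gt] unfolding \<rho>_def by auto
  have "1 - c' < (1 - \<alpha> - sqrt (1 - 2 * \<alpha> - \<alpha>\<^sup>2)) / 2" using c' by linarith
  then have "\<forall>\<^sub>F n in sequentially. (1 - c') * x (\<rho> n) \<le> x (n - 1)"
    by (intro eventually_ratio_ge[where P = P and \<alpha> = \<alpha>])
      (use pos mono P \<rho>_mono \<rho>_gt ineq sums \<alpha>_pos in auto)
  moreover have "\<forall>\<^sub>F n in sequentially. n > N" by (rule eventually_gt_at_top)
  ultimately have "\<forall>\<^sub>F n in sequentially. ereal (\<Sum>j=n..\<rho> n. \<Sum>i=1..m.
                      p i j * inverse (b_r m p \<sigma> r (\<rho> n) (\<sigma> i j))) \<le> ereal c'"
  proof eventually_elim
    case (elim n)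
    let ?s = "\<Sum>j=n..\<rho> n. \<Sum>i=1..m. p i j * inverse (b_r m p \<sigma> r (\<rho> n) (\<sigma> i j))"
    have \<rho>n: "x (\<rho> n) > 0" "n < \<rho> n" using pos[of "\<rho> n"] \<rho>_gt[of n] elim by auto
    \<comment> \<open>Since \<open>j \<ge> n\<close> gives
      \<open>\<sigma> i j \<ge> \<rho> n\<close>, the \<open>b_r\<close> bound compares
      \<open>x (\<sigma> i j)\<close> with \<open>x (\<rho> n)\<close>. The right side telescopes
      down to \<open>x (n - 1)\<close>, as the sum includes \<open>j = n\<close>.\<close>
    have "?s * x (\<rho> n) \<le> (\<Sum>j=n..\<rho> n. \<Sum>i=1..m. p i j * x (\<sigma> i j))"
      unfolding sum_distrib_right
    proof (intro sum_mono)
      fix i j assume ij: "j \<in> {n..\<rho> n}" "i \<in> {1..m}"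
      let ?b = "b_r m p \<sigma> r (\<rho> n) (\<sigma> i j)"
      have "?b > 0 \<and> x (\<rho> n) \<le> ?b * x (\<sigma> i j)"
        using le_b_r_mult[OF pos mono p_nonneg \<sigma>_gt eq _ _ r] \<rho>_le[OF ij(2)] ij(1) \<rho>n elim
        by simp
      then have "inverse ?b * x (\<rho> n) \<le> x (\<sigma> i j)" by (simp add: field_simps)
      then show "p i j * inverse ?b * x (\<rho> n) \<le> p i j * x (\<sigma> i j)"
        unfolding mult.assoc using p_nonneg[OF ij(2)] by (intro mult_left_mono) auto
    qed
    also have "\<dots> = (\<Sum>j=n..<Suc (\<rho> n). x j - x (j - 1))"
    proof (rule sum.cong)
      fix j assume "j \<in> {n..<Suc (\<rho> n)}"
      then show "(\<Sum>i=1..m. p i j * x (\<sigma> i j)) = x j - x (j - 1)"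
        using elim by (intro eq[symmetric]) simp
    qed auto
    also have "\<dots> = x (\<rho> n) - x (n - 1)" using \<rho>n elim by (subst sum_diff_pred) auto
    also have "\<dots> \<le> c' * x (\<rho> n)" using elim by (simp add: algebra_simps)
    finally show ?case using \<rho>n by (simp add: mult_le_cancel_right)
  qed
  from Limsup_bounded[OF this] limsup_c' show False by simp
qed

theorem mainTheorem4:
  fixes m :: nat
    and p :: "nat \<Rightarrow> nat \<Rightarrow> real"
    and \<sigma> :: "nat \<Rightarrow> nat \<Rightarrow> nat"
    and \<alpha> :: real
  assumes m: "m \<ge> 1"
    and p_nonneg: "\<And>i n. i \<in> {1..m} \<Longrightarrow> p i n \<ge> 0"
    and p_sum: "\<And>n. (\<Sum>i=1..m. p i n) < 1"
    and \<sigma>_adv: "\<And>i n. i \<in> {1..m} \<Longrightarrow> n \<ge> 1 \<Longrightarrow> \<sigma> i n \<ge> n + 1"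
    and \<alpha>_eq: "ereal \<alpha> = (MIN i\<in>{1..m}. alpha_i p \<sigma> i)"
    and \<alpha>_pos: "0 < \<alpha>"
    and \<alpha>_le: "\<alpha> \<le> 1 / exp 1"
    and limsup_gt: "\<exists>r\<ge>1. limsup (\<lambda>n. ereal (\<Sum>j=n..rho m \<sigma> n. \<Sum>i=1..m.
                      p i j * inverse (b_r m p \<sigma> r (rho m \<sigma> n) (\<sigma> i j))))
                    > ereal (1 - (1 - \<alpha> - sqrt (1 - 2 * \<alpha> - \<alpha>\<^sup>2)) / 2)"
  shows "\<forall>x. is_solution m p \<sigma> x \<longrightarrow> oscillatory x"
proof (intro allI impI)
  fix x assume sol: "is_solution m p \<sigma> x"
  \<comment> \<open>The equation is linear, so an eventually negative solution is excluded by
    passing to its negative.\<close>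
  then have "is_solution m p \<sigma> (\<lambda>n. - x n)"
    unfolding is_solution_def by (simp add: sum_negf algebra_simps)
  moreover obtain r where r: "r \<ge> 1" "limsup (\<lambda>n. ereal (\<Sum>j=n..rho m \<sigma> n. \<Sum>i=1..m.
                      p i j * inverse (b_r m p \<sigma> r (rho m \<sigma> n) (\<sigma> i j))))
                    > ereal (1 - (1 - \<alpha> - sqrt (1 - 2 * \<alpha> - \<alpha>\<^sup>2)) / 2)"
    using limsup_gt by blast
  note not_eventually_pos[OF m p_nonneg \<sigma>_adv \<alpha>_eq \<alpha>_pos r]
  ultimately show "oscillatory x" using sol unfolding oscillatory_def by force
qed

end
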